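(* Let $P\subseteq\Phi_{B_n}$ be a signed poset and $k$ a field. Let $S_P^{\mathrm{wt}}=k[U_J: J \text{ a connected ideal of }P]$ and let $\phi\colon S_P^{\mathrm{wt}}\to k[x_1^{\pm1},\dots,x_n^{\pm1}]$, $U_J\mapsto \mathbf x^{\chi_J}$. Then $\phi$ maps onto $R_P^{\mathrm{wt}}=k[K_P^{\mathrm{wt}}\cap\mathbb{Z}^n]$ and there is an exact sequence $$0\to I_P^{\mathrm{wt}}\to S_P^{\mathrm{wt}}\xrightarrow{\phi} R_P^{\mathrm{wt}}\to0,\qquad I_P^{\mathrm{wt}}=\bigl(\mathrm{syz}(U_{J_1},U_{J_2}) : \{J_1,J_2\}\in\Pi(P)\bigr),$$ where $\mathrm{syz}(U_{J_1},U_{J_2})=U_{J_1}U_{J_2}-\prod_i U_{J^{(i)}}\prod_j U_{K^{(j)}}$, with $J^{(i)}$ the connected components of $J_1\cap J_2$ and $K^{(j)}$ the connected components of $\mathrm{supp}_\pm(\chi_{J_1}+\chi_{J_2})$.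
   Context: $\Phi_{B_n}=\{\pm e_i\pm e_j:i<j\}\cup\{\pm e_i\}\subset\mathbb{R}^n$. A signed poset is $P\subseteq\Phi_{B_n}$ with $\alpha\in P\Rightarrow-\alpha\notin P$ and $P=\mathbb{R}_{\ge0}P\cap\Phi_{B_n}$. Let $P^\vee=\{2\alpha/\langle\alpha,\alpha\rangle:\alpha\in P\}$ and let $\widehat G_C(P^\vee)$ be the partial order on $\pm[n]$ generated (transitive closure) by $\delta i<\epsilon j$, $-\epsilon j<-\delta i$ whenever $\delta e_i-\epsilon e_j\in P^\vee$ ($i\ne j$, $\delta,\epsilon=\pm1$) and $\delta i<-\delta i$ whenever $2\delta e_i\in P^\vee$. An ideal of $P$ is a vector $f\in\{0,1,-1\}^n$ with $\langle f,\alpha\rangle\ge0$ for all $\alpha\in P$; it is identified with the signed set $\{\mathrm{sgn}(f_i)i: f_i\ne0\}\subseteq\pm[n]$, and for such a signed set $J$ (containing no pair $i,-i$) $\chi_J$ is its characteristic vector ($+1$ at $i$ if $i\in J$, $-1$ if $-i\in J$, else $0$). Ideals are exactly the order ideals of $\widehat G_C(P^\vee)$ containing no pair $i,-i$. An ideal is connected if it is nonempty and induces a connected subgraph of the Hasse diagram of $\widehat G_C(P^\vee)$; connected components of a signed subset are taken in that induced subgraph. $\mathrm{supp}J=\{|i|:i\in J\}$. Two ideals $J,K$ intersect nontrivially if $\mathrm{supp}J\cap\mathrm{supp}K\ne\emptyset$ and neither $J\subseteq K$ nor $K\subseteq J$; $\Pi(P)$ is the set of unordered pairs of nontrivially intersecting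 connected ideals. For $f\in\mathbb{Z}^n$, $\mathrm{supp}_\pm(f)=\{\mathrm{sgn}(f_i)i: f_i\neq0\}$. The weight cone is $K_P^{\mathrm{wt}}=\{f\in\mathbb{R}^n:\langle f,\alpha\rangle\ge0\ \forall\alpha\in P\}$ and $R_P^{\mathrm{wt}}$ is the span of $\mathbf x^f$, $f\in K_P^{\mathrm{wt}}\cap\mathbb{Z}^n$. *)

theory Defs
  imports
    "HOL-Analysis.Analysis"
    "HOL-Algebra.RingHom"
    "HOL-Library.Poly_Mapping"
begin

text \<open>
  The index set \<open>[n]\<close> is an arbitrary finite type \<open>'n\<close>, and \<open>\<plusminus>[n]\<close> is the type of signed indices.
  Integer vectors \<open>int ^ 'n\<close> carry exponents of Laurent monomials; \<open>rvec\<close> embeds them in Euclidean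
  space.
\<close>

datatype 'n signed = Pos 'n | Neg 'n

primrec idx :: "'n signed \<Rightarrow> 'n" where
  "idx (Pos i) = i"
| "idx (Neg i) = i"

primrec opp :: "'n signed \<Rightarrow> 'n signed" where
  "opp (Pos i) = Neg i"
| "opp (Neg i) = Pos i"

text \<open>\<open>evec a\<close> is \<open>\<delta> e\<^sub>i\<close> for the signed index \<open>a = \<delta> i\<close>.\<close>

primrec evec :: "'n::finite signed \<Rightarrow> real ^ 'n" where
  "evec (Pos i) = axis i 1"
| "evec (Neg i) = - axis i 1"

definition rvec :: "int ^ 'n \<Rightarrow> real ^ 'n" where
  "rvec f = (\<chi> i. real_of_int (f $ i))"


subsection \<open>Signed posets and their partial order on signed indices\<close>

definition Phi_B :: "(real ^ 'n::finite) set" where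
  "Phi_B = {evec a + evec b | a b. idx a \<noteq> idx b} \<union> range evec"

text \<open>The set of nonnegative linear combinations of \<open>P\<close> is \<open>convex_cone hull P\<close>; it contains \<open>0\<close>
  also for \<open>P = {}\<close>.\<close>

definition signed_poset :: "(real ^ 'n::finite) set \<Rightarrow> bool" where
  "signed_poset P \<longleftrightarrow>
     P \<subseteq> Phi_B \<and> (\<forall>\<alpha>\<in>P. - \<alpha> \<notin> P) \<and> P = (convex_cone hull P) \<inter> Phi_B"

definition dual :: "(real ^ 'n::finite) set \<Rightarrow> (real ^ 'n) set" where
  "dual P = {(2 / (\<alpha> \<bullet> \<alpha>)) *\<^sub>R \<alpha> | \<alpha>. \<alpha> \<in> P}"

text \<open>The strict order: a pair \<open>(a, b)\<close> means \<open>a < b\<close>.\<close>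

definition GC_gen :: "(real ^ 'n::finite) set \<Rightarrow> ('n signed \<times> 'n signed) set" where
  "GC_gen Q =
     {(a, b). idx a \<noteq> idx b \<and> evec a - evec b \<in> Q}
   \<union> {(opp b, opp a) | a b. idx a \<noteq> idx b \<and> evec a - evec b \<in> Q}
   \<union> {(a, opp a) | a. 2 *\<^sub>R evec a \<in> Q}"

definition GC :: "(real ^ 'n::finite) set \<Rightarrow> ('n signed \<times> 'n signed) set" where
  "GC P = (GC_gen (dual P))\<^sup>+"

definition covering :: "('v \<times> 'v) set \<Rightarrow> ('v \<times> 'v) set" where
  "covering r = {(a, b) \<in> r. \<not> (\<exists>c. (a, c) \<in> r \<and> (c, b) \<in> r)}"

text \<open>Adjacency in the subgraph of the (undirected) Hasse diagram induced on \<open>A\<close>.\<close>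

definition hasse_adj :: "(real ^ 'n::finite) set \<Rightarrow> 'n signed set \<Rightarrow> ('n signed \<times> 'n signed) set" where
  "hasse_adj P A = (covering (GC P) \<union> (covering (GC P))\<inverse>) \<inter> A \<times> A"

definition connected_in :: "(real ^ 'n::finite) set \<Rightarrow> 'n signed set \<Rightarrow> bool" where
  "connected_in P A \<longleftrightarrow> (\<forall>a\<in>A. \<forall>b\<in>A. (a, b) \<in> (hasse_adj P A)\<^sup>*)"

definition components_in :: "(real ^ 'n::finite) set \<Rightarrow> 'n signed set \<Rightarrow> 'n signed set set" where
  "components_in P A = A // (hasse_adj P A)\<^sup>*"


subsection \<open>Ideals\<close>

definition weight_cone :: "(real ^ 'n::finite) set \<Rightarrow> (real ^ 'n) set" where
  "weight_cone P = {f. \<forall>\<alpha>\<in>P. f \<bullet> \<alpha> \<ge> 0}"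

definition supp_pm :: "int ^ 'n \<Rightarrow> 'n signed set" where
  "supp_pm f = {Pos i | i. f $ i > 0} \<union> {Neg i | i. f $ i < 0}"

definition chi_vec :: "'n signed set \<Rightarrow> int ^ 'n" where
  "chi_vec J = (\<chi> i. if Pos i \<in> J then 1 else if Neg i \<in> J then - 1 else 0)"

definition ideal_vec :: "(real ^ 'n::finite) set \<Rightarrow> int ^ 'n \<Rightarrow> bool" where
  "ideal_vec P f \<longleftrightarrow> (\<forall>i. f $ i \<in> {0, 1, - 1}) \<and> (\<forall>\<alpha>\<in>P. rvec f \<bullet> \<alpha> \<ge> 0)"

text \<open>Ideals as signed sets, under the identification \<open>f \<mapsto> supp_pm f\<close>, whose inverse is
  \<open>chi_vec\<close>.\<close>

definition poset_ideals :: "(real ^ 'n::finite) set \<Rightarrow> 'n signed set set" where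
  "poset_ideals P = supp_pm ` {f. ideal_vec P f}"

lemma chi_vec_supp_pm: "ideal_vec P f \<Longrightarrow> chi_vec (supp_pm f) = f"
proof -
  assume "ideal_vec P f"
  then have cases: "f $ i = 0 \<or> f $ i = 1 \<or> f $ i = - 1" for i
    by (simp add: ideal_vec_def)
  have "chi_vec (supp_pm f) $ i = f $ i" for i
    using cases[of i] by (auto simp: chi_vec_def supp_pm_def)
  then show ?thesis
    by (simp add: vec_eq_iff)
qed

definition conn_ideals :: "(real ^ 'n::finite) set \<Rightarrow> 'n signed set set" where
  "conn_ideals P = {J \<in> poset_ideals P. J \<noteq> {} \<and> connected_in P J}"

definition nontriv_intersect :: "'n signed set \<Rightarrow> 'n signed set \<Rightarrow> bool" where
  "nontriv_intersect J K \<longleftrightarrow> idx ` J \<inter> idx ` K \<noteq> {} \<and> \<not> J \<subseteq> K \<and> \<not> K \<subseteq> J"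

definition Pi_pairs :: "(real ^ 'n::finite) set \<Rightarrow> 'n signed set set set" where
  "Pi_pairs P = {{J, K} | J K. J \<in> conn_ideals P \<and> K \<in> conn_ideals P \<and> nontriv_intersect J K}"


subsection \<open>The rings\<close>

text \<open>
  An element of \<open>('v \<Rightarrow>\<^sub>0 nat) \<Rightarrow>\<^sub>0 'k\<close> is a polynomial over \<open>'k\<close> in indeterminates indexed by
  \<open>'v\<close>, and one of \<open>(int ^ 'n) \<Rightarrow>\<^sub>0 'k\<close> is a Laurent polynomial; multiplication is convolution.
\<close>

definition ring_on :: "'a::comm_ring_1 set \<Rightarrow> 'a ring" where
  "ring_on A = \<lparr>carrier = A, mult = (*), one = 1, zero = 0, add = (+)\<rparr>"

definition const :: "'k::comm_ring_1 \<Rightarrow> ('m::comm_monoid_add \<Rightarrow>\<^sub>0 'k)" where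
  "const c = Poly_Mapping.single 0 c"

definition polys_in :: "'v set \<Rightarrow> (('v \<Rightarrow>\<^sub>0 nat) \<Rightarrow>\<^sub>0 'k::comm_ring_1) set" where
  "polys_in V = {p. \<forall>m \<in> Poly_Mapping.keys p. Poly_Mapping.keys m \<subseteq> V}"

definition U :: "'v \<Rightarrow> (('v \<Rightarrow>\<^sub>0 nat) \<Rightarrow>\<^sub>0 'k::comm_ring_1)" where
  "U v = Poly_Mapping.single (Poly_Mapping.single v 1) 1"

definition xmon :: "int ^ 'n \<Rightarrow> ((int ^ 'n) \<Rightarrow>\<^sub>0 'k::comm_ring_1)" where
  "xmon f = Poly_Mapping.single f 1"

definition S_wt ::
  "(real ^ 'n::finite) set \<Rightarrow> (('n signed set \<Rightarrow>\<^sub>0 nat) \<Rightarrow>\<^sub>0 'k::field) ring" where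
  "S_wt P = ring_on (polys_in (conn_ideals P))"

definition R_wt :: "(real ^ 'n::finite) set \<Rightarrow> ((int ^ 'n) \<Rightarrow>\<^sub>0 'k::field) ring" where
  "R_wt P = ring_on (module.span (\<lambda>c p. const c * p) {xmon f | f. rvec f \<in> weight_cone P})"

lemma vector_space_const:
  "vector_space (\<lambda>(c::'k::field) (p :: 'm::comm_monoid_add \<Rightarrow>\<^sub>0 'k). const c * p)"
  by unfold_locales
     (simp_all add: const_def algebra_simps single_add mult_single flip: mult.assoc)

definition phi ::
  "(('n::finite signed set \<Rightarrow>\<^sub>0 nat) \<Rightarrow>\<^sub>0 'k::field) \<Rightarrow> ((int ^ 'n) \<Rightarrow>\<^sub>0 'k)" where
  "phi p = (\<Sum>m\<in>Poly_Mapping.keys p. const (Poly_Mapping.lookup p m) *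
              (\<Prod>J\<in>Poly_Mapping.keys m. xmon (chi_vec J) ^ Poly_Mapping.lookup m J))"

lemma phi_U: "phi (U J) = xmon (chi_vec J)"
  by (simp add: phi_def U_def const_def)

lemma phi_const: "phi (const c) = const c"
  by (simp add: phi_def const_def)

definition syz ::
  "(real ^ 'n::finite) set \<Rightarrow> 'n signed set \<Rightarrow> 'n signed set \<Rightarrow>
    (('n signed set \<Rightarrow>\<^sub>0 nat) \<Rightarrow>\<^sub>0 'k::field)" where
  "syz P J\<^sub>1 J\<^sub>2 = U J\<^sub>1 * U J\<^sub>2 -
     (\<Prod>J\<in>components_in P (J\<^sub>1 \<inter> J\<^sub>2). U J) *
     (\<Prod>K\<in>components_in P (supp_pm (chi_vec J\<^sub>1 + chi_vec J\<^sub>2)). U K)"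

definition I_wt ::
  "(real ^ 'n::finite) set \<Rightarrow> (('n signed set \<Rightarrow>\<^sub>0 nat) \<Rightarrow>\<^sub>0 'k::field) set" where
  "I_wt P = Idl\<^bsub>S_wt P\<^esub> {syz P J\<^sub>1 J\<^sub>2 | J\<^sub>1 J\<^sub>2. {J\<^sub>1, J\<^sub>2} \<in> Pi_pairs P}"

end

(*
  A vector lies in the weight cone iff its signed coordinates are order-reversing on the poset
  of signed indices, so ideals are the order ideals without opposite pairs, and phi is the linear
  extension of the degree map sending a monomial of connected ideals to the sum of the vectors
  chi_J.  Peeling off chi of the signed support shows that every lattice point of the cone is a
  degree.  Modulo the syzygies every monomial becomes standard, i.e. any two of its ideals are
  nested or have disjoint supports, and a standard monomial is determined by its degree.  Hence
  p is congruent to the image of phi(p) under the linear map replacing each degree by its standard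
  monomial, and this image vanishes when phi(p) = 0.
*)

theory Submission
  imports Defs
begin

text \<open>What shapes the signed case is cancellation. Two ideals with meeting supports may
  contain opposite indices; then their union is not an ideal, their intersection can be empty, and
  the signed support of the sum of their vectors can be disconnected or empty. For
  \<open>P = {}\<close> the pair \<open>{Pos i}\<close>, \<open>{Neg i}\<close> has the syzygy
  \<open>U {Pos i} * U {Neg i} - 1\<close>. Straightening therefore preserves neither the number of
  factors nor, in general, the total size of the ideals, and its termination needs a weight that
  falls both with and without cancellation. In a standard monomial nothing cancels, since nested
  ideals cannot contain opposite indices; this is what makes its degree readable. No term order is
  needed for the kernel: the standard form of a monomial depends on its degree alone, and collecting
  coefficients by degree is exactly what \<open>phi\<close> does.\<close>

section \<open>Signed coordinates\<close>

text \<open>\<open>sval f a\<close> is \<open>\<langle>f, \<delta> e\<^sub>i\<rangle>\<close> for the signed index \<open>a = \<delta> i\<close>; in these coordinates the weight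
  cone consists of the order-reversing odd functions.\<close>

primrec sval :: "int ^ 'n \<Rightarrow> 'n signed \<Rightarrow> int" where
  "sval f (Pos i) = f $ i"
| "sval f (Neg i) = - f $ i"

lemma opp_opp [simp]: "opp (opp a) = a"
  by (cases a) auto

lemma opp_neq [simp]: "opp a \<noteq> a" "a \<noteq> opp a"
  by (cases a; simp)+

lemma idx_opp [simp]: "idx (opp a) = idx a"
  by (cases a) auto

lemma idx_eq_iff: "idx a = idx b \<longleftrightarrow> a = b \<or> a = opp b"
  by (cases a; cases b) auto

lemma evec_opp [simp]: "evec (opp a) = - evec a"
  by (cases a) auto

lemma sval_opp [simp]: "sval f (opp a) = - sval f a"
  by (cases a) auto

lemma sval_zero [simp]: "sval 0 a = 0"
  by (cases a) auto

lemma sval_add [simp]: "sval (f + g) a = sval f a + sval g a"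
  by (cases a) auto

lemma sval_diff [simp]: "sval (f - g) a = sval f a - sval g a"
  by (cases a) auto

lemma sval_sum: "sval (sum F A) a = (\<Sum>x\<in>A. sval (F x) a)"
  by (induction A rule: infinite_finite_induct) auto

lemma sval_of_nat_mult: "sval (of_nat k * f) a = int k * sval f a"
  by (induction k) (auto simp: algebra_simps)

lemma sval_eqI: "(\<And>a. sval f a = sval g a) \<Longrightarrow> f = g"
  by (metis sval.simps(1) vec_eq_iff)

lemma inner_rvec_evec: "rvec f \<bullet> evec a = real_of_int (sval f a)"
  by (cases a) (auto simp: rvec_def inner_axis)

lemma finite_signed [simp]: "finite (A :: 'n::finite signed set)"
proof -
  have "A \<subseteq> range Pos \<union> range Neg"
  proof
    show "a \<in> range Pos \<union> range Neg" for a :: "'n signed"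
      by (cases a) auto
  qed
  then show ?thesis
    by (rule finite_subset) simp
qed

lemma mem_supp_pm: "a \<in> supp_pm f \<longleftrightarrow> sval f a > 0"
  by (cases a) (auto simp: supp_pm_def)

text \<open>The hypothesis matters because \<open>chi_vec\<close> would resolve an opposite pair in
  favour of \<open>Pos\<close>, where the difference of indicators is 0.\<close>

lemma sval_chi_vec:
  assumes "\<forall>a\<in>J. opp a \<notin> J"
  shows "sval (chi_vec J) a = of_bool (a \<in> J) - of_bool (opp a \<in> J)"
  using assms by (cases a) (auto simp: chi_vec_def dest: bspec)


section \<open>The order on signed indices\<close>

definition downset :: "('v \<times> 'v) set \<Rightarrow> 'v set \<Rightarrow> bool" where
  "downset r A \<longleftrightarrow> (\<forall>a b. (a, b) \<in> r \<longrightarrow> b \<in> A \<longrightarrow> a \<in> A)"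

lemma Phi_B_uminus: "\<alpha> \<in> Phi_B \<Longrightarrow> - \<alpha> \<in> Phi_B"
proof -
  assume "\<alpha> \<in> Phi_B"
  then consider a b where "\<alpha> = evec a + evec b" "idx a \<noteq> idx b" | a where "\<alpha> = evec a"
    by (auto simp: Phi_B_def)
  then show ?thesis
  proof cases
    case 1
    then have "- \<alpha> = evec (opp a) + evec (opp b)" "idx (opp a) \<noteq> idx (opp b)"
      by auto
    then show ?thesis
      unfolding Phi_B_def by blast
  next
    case 2
    then have "- \<alpha> = evec (opp a)"
      by simp
    then show ?thesis
      unfolding Phi_B_def by blast
  qed
qed

locale signed_poset_order =
  fixes P :: "(real ^ 'n::finite) set"
  assumes sp: "signed_poset P"
begin

text \<open>All three families of generators have their difference in \<open>dual P\<close>: passing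
  from \<open>(a, b)\<close> to \<open>(opp b, opp a)\<close> leaves it unchanged, and the pair
  \<open>(a, opp a)\<close> has difference twice \<open>evec a\<close>.\<close>

lemma GC_gen_root:
  assumes "(a, b) \<in> GC_gen (dual P)"
  obtains \<alpha> c where "\<alpha> \<in> P" "c > 0" "evec a - evec b = c *\<^sub>R \<alpha>"
proof -
  have "evec a - evec b \<in> dual P"
    using assms by (auto simp: GC_gen_def scaleR_2)
  then obtain \<alpha> where \<alpha>: "\<alpha> \<in> P" "evec a - evec b = (2 / (\<alpha> \<bullet> \<alpha>)) *\<^sub>R \<alpha>"
    by (auto simp: dual_def)
  have "\<alpha> \<noteq> 0"
    using sp \<alpha>(1) unfolding signed_poset_def by force
  then show ?thesis
    using that[of \<alpha> "2 / (\<alpha> \<bullet> \<alpha>)"] \<alpha> by simp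
qed

text \<open>Differences telescope along a chain of generators, and the cone is closed under addition
  and nonnegative scaling.\<close>

lemma GC_diff_in_cone: "(a, b) \<in> GC P \<Longrightarrow> evec a - evec b \<in> convex_cone hull P"
  unfolding GC_def
proof (induction rule: trancl_induct)
  case (base b)
  then show ?case
    by (metis GC_gen_root convex_cone_convex_cone_hull convex_cone_scaleR hull_inc less_imp_le)
next
  case (step b c)
  have "evec b - evec c \<in> convex_cone hull P"
    using step(2)
    by (metis GC_gen_root convex_cone_convex_cone_hull convex_cone_scaleR hull_inc less_imp_le)
  then have "(evec a - evec b) + (evec b - evec c) \<in> convex_cone hull P"
    using convex_cone_add convex_cone_convex_cone_hull step(3) by blast
  then show ?case
    by simp
qed

text \<open>The first generator of a cycle is a positive multiple of a root \<alpha> of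
  \<open>P\<close>, and the rest of the cycle puts \<open>- \<alpha>\<close> into the cone. Since
  \<open>P\<close> contains every root of its cone, \<open>- \<alpha>\<close> would lie in
  \<open>P\<close> too.\<close>

lemma GC_irrefl: "(a, a) \<notin> GC P"
proof
  assume "(a, a) \<in> GC P"
  then obtain c where c: "(a, c) \<in> GC_gen (dual P)" "(c, a) \<in> (GC_gen (dual P))\<^sup>*"
    unfolding GC_def by (meson tranclD)
  obtain \<alpha> r where \<alpha>: "\<alpha> \<in> P" "r > 0" "evec a - evec c = r *\<^sub>R \<alpha>"
    using GC_gen_root[OF c(1)] .
  have "evec c - evec a \<in> convex_cone hull P"
  proof (cases "c = a")
    case True
    then show ?thesis
      by (simp add: convex_cone_contains_0 convex_cone_convex_cone_hull)
  next
    case False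
    then show ?thesis
      using c(2) GC_diff_in_cone by (simp add: GC_def rtrancl_eq_or_trancl)
  qed
  then have "(1 / r) *\<^sub>R (evec c - evec a) \<in> convex_cone hull P"
    using \<alpha>(2) by (simp add: convex_cone_convex_cone_hull convex_cone_scaleR)
  moreover have "evec c - evec a = r *\<^sub>R (- \<alpha>)"
    using \<alpha>(3) by (metis minus_diff_eq scaleR_minus_right)
  ultimately have "- \<alpha> \<in> convex_cone hull P"
    using \<alpha>(2) by simp
  moreover have "- \<alpha> \<in> Phi_B"
    using sp \<alpha>(1) Phi_B_uminus unfolding signed_poset_def by blast
  ultimately show False
    using sp \<alpha>(1) unfolding signed_poset_def by blast
qed

lemma trans_GC: "trans (GC P)"
  by (simp add: GC_def)

text \<open>Negation reverses the order already on generators: it exchanges the first two families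
  and fixes every pair \<open>(a, opp a)\<close>.\<close>

lemma GC_opp: "(a, b) \<in> GC P \<Longrightarrow> (opp b, opp a) \<in> GC P"
  unfolding GC_def
proof (induction rule: trancl_induct)
  case (base b)
  then have "(opp b, opp a) \<in> GC_gen (dual P)"
    by (fastforce simp: GC_gen_def)
  then show ?case
    by auto
next
  case (step b c)
  then have "(opp c, opp b) \<in> GC_gen (dual P)"
    by (fastforce simp: GC_gen_def)
  then show ?case
    using step(3) by auto
qed

text \<open>A root of squared length 2 is its own coroot.\<close>

lemma GC_root_diff:
  assumes "evec a - evec b \<in> P" "idx a \<noteq> idx b"
  shows "(a, b) \<in> GC P"
proof -
  have "evec a \<bullet> evec b = 0" "evec a \<bullet> evec a = 1" "evec b \<bullet> evec b = 1"
    using assms(2) by (cases a; cases b; simp add: inner_axis_axis)+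
  then have "(evec a - evec b) \<bullet> (evec a - evec b) = 2"
    by (simp add: inner_diff inner_commute)
  then have "evec a - evec b \<in> dual P"
    using assms(1) by (force simp: dual_def)
  then show ?thesis
    using assms(2) by (auto simp: GC_def GC_gen_def)
qed

text \<open>The coroot of a unit root is twice the root, which is what the generators
  \<open>(a, opp a)\<close> ask for.\<close>

lemma GC_root_unit:
  assumes "evec a \<in> P"
  shows "(a, opp a) \<in> GC P"
proof -
  have "evec a \<bullet> evec a = 1"
    by (cases a) (simp_all add: inner_axis_axis)
  then have "2 *\<^sub>R evec a \<in> dual P"
    using assms by (force simp: dual_def)
  then show ?thesis
    by (auto simp: GC_def GC_gen_def)
qed

text \<open>Pairing with \<open>evec a - evec b\<close> yields \<open>sval f a - sval f b\<close>,
  so each generator of the order states one root inequality up to a positive factor. Conversely,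
  \<open>evec a + evec b\<close> is the difference of \<open>evec a\<close> and
  \<open>evec (opp b)\<close>, and a unit root gives \<open>sval f (opp a) \<le> sval f a\<close>,
  that is, \<open>sval f a \<ge> 0\<close>.\<close>

lemma weight_cone_iff:
  "rvec f \<in> weight_cone P \<longleftrightarrow> (\<forall>(a, b)\<in>GC P. sval f b \<le> sval f a)"
proof safe
  fix a b assume f: "rvec f \<in> weight_cone P" and "(a, b) \<in> GC P"
  have gen: "sval f b \<le> sval f a" if gen: "(a, b) \<in> GC_gen (dual P)" for a b
  proof -
    obtain \<alpha> r where \<alpha>: "\<alpha> \<in> P" "r > 0" "evec a - evec b = r *\<^sub>R \<alpha>"
      using GC_gen_root[OF gen] .
    have "rvec f \<bullet> (evec a - evec b) \<ge> 0"
      using f \<alpha> by (auto simp: weight_cone_def)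
    then show ?thesis
      by (simp add: inner_diff_right inner_rvec_evec)
  qed
  show "sval f b \<le> sval f a"
    using \<open>(a, b) \<in> GC P\<close> unfolding GC_def
    by (induction rule: trancl_induct) (use gen in force)+
next
  assume mono: "\<forall>(a, b)\<in>GC P. sval f b \<le> sval f a"
  have "rvec f \<bullet> \<alpha> \<ge> 0" if "\<alpha> \<in> P" for \<alpha>
  proof -
    have "\<alpha> \<in> Phi_B"
      using sp that by (auto simp: signed_poset_def)
    then consider a b where "\<alpha> = evec a + evec b" "idx a \<noteq> idx b" | a where "\<alpha> = evec a"
      by (auto simp: Phi_B_def)
    then show ?thesis
    proof cases
      case 1
      then have "(a, opp b) \<in> GC P"
        using that by (intro GC_root_diff) auto
      then have "sval f (opp b) \<le> sval f a"
        using mono by blast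
      then show ?thesis
        by (simp add: 1 inner_add_right inner_rvec_evec)
    next
      case 2
      then have "(a, opp a) \<in> GC P"
        using that by (intro GC_root_unit) auto
      then have "sval f (opp a) \<le> sval f a"
        using mono by blast
      then show ?thesis
        by (simp add: 2 inner_rvec_evec)
    qed
  qed
  then show "rvec f \<in> weight_cone P"
    by (simp add: weight_cone_def)
qed


section \<open>Ideals and their connected components\<close>

lemma downset_supp_pm: "rvec f \<in> weight_cone P \<Longrightarrow> downset (GC P) (supp_pm f)"
  unfolding weight_cone_iff downset_def mem_supp_pm by fastforce

text \<open>By \<open>GC_opp\<close>, going down in the order can only bring an index into
  \<open>J\<close> and only take its opposite out of \<open>J\<close>; the difference of the two
  indicators therefore cannot fall.\<close>

lemma chi_vec_in_weight_cone:
  assumes "downset (GC P) J" "\<forall>a\<in>J. opp a \<notin> J"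
  shows "rvec (chi_vec J) \<in> weight_cone P"
  unfolding weight_cone_iff
proof safe
  fix a b assume ab: "(a, b) \<in> GC P"
  then have "b \<in> J \<Longrightarrow> a \<in> J" "opp a \<in> J \<Longrightarrow> opp b \<in> J"
    using assms(1) GC_opp unfolding downset_def by blast+
  then show "sval (chi_vec J) b \<le> sval (chi_vec J) a"
    using assms(2) by (auto simp: sval_chi_vec)
qed

lemma poset_ideals_iff:
  "J \<in> poset_ideals P \<longleftrightarrow> downset (GC P) J \<and> (\<forall>a\<in>J. opp a \<notin> J)"
proof safe
  assume "J \<in> poset_ideals P"
  then obtain f where "J = supp_pm f" "rvec f \<in> weight_cone P"
    by (auto simp: poset_ideals_def ideal_vec_def weight_cone_def)
  then show "downset (GC P) J" and "\<And>a. a \<in> J \<Longrightarrow> opp a \<in> J \<Longrightarrow> False"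
    by (auto simp: downset_supp_pm mem_supp_pm)
next
  assume J: "downset (GC P) J" "\<forall>a\<in>J. opp a \<notin> J"
  have "J = supp_pm (chi_vec J)"
    using J(2) by (auto simp: mem_supp_pm sval_chi_vec)
  moreover have "ideal_vec P (chi_vec J)"
    using chi_vec_in_weight_cone[OF J] by (auto simp: ideal_vec_def weight_cone_def chi_vec_def)
  ultimately show "J \<in> poset_ideals P"
    unfolding poset_ideals_def by blast
qed

lemma supp_pm_ideal: "rvec f \<in> weight_cone P \<Longrightarrow> supp_pm f \<in> poset_ideals P"
  by (simp add: poset_ideals_iff downset_supp_pm mem_supp_pm)

lemma ideal_Int: "J \<in> poset_ideals P \<Longrightarrow> K \<in> poset_ideals P \<Longrightarrow> J \<inter> K \<in> poset_ideals P"
  by (auto simp: poset_ideals_iff downset_def)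

lemma sval_chi_ideal:
  "J \<in> poset_ideals P \<Longrightarrow> sval (chi_vec J) a = of_bool (a \<in> J) - of_bool (opp a \<in> J)"
  by (simp add: poset_ideals_iff sval_chi_vec)

lemma ideal_weight_cone: "J \<in> poset_ideals P \<Longrightarrow> rvec (chi_vec J) \<in> weight_cone P"
  by (simp add: poset_ideals_iff chi_vec_in_weight_cone)

text \<open>A relation refines to a chain of covers, by induction on the number of elements strictly
  in between; the chain stays inside \<open>A\<close> because everything below \<open>b\<close>
  does.\<close>

lemma GC_path:
  assumes "(a, b) \<in> GC P" "downset (GC P) A" "b \<in> A"
  shows "(a, b) \<in> (hasse_adj P A)\<^sup>*"
  using assms
proof (induction "card {c. (a, c) \<in> GC P \<and> (c, b) \<in> GC P}" arbitrary: a b rule: less_induct)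
  case less
  show ?case
  proof (cases "\<exists>c. (a, c) \<in> GC P \<and> (c, b) \<in> GC P")
    case True
    then obtain c where c: "(a, c) \<in> GC P" "(c, b) \<in> GC P"
      by blast
    have "c \<in> A"
      using c(2) less.prems unfolding downset_def by blast
    \<comment> \<open>Both inclusions are strict because irreflexivity keeps \<open>c\<close> itself
      out of the two smaller intervals.\<close>
    have "{d. (a, d) \<in> GC P \<and> (d, c) \<in> GC P} \<subset> {d. (a, d) \<in> GC P \<and> (d, b) \<in> GC P}"
      using c GC_irrefl transD[OF trans_GC] by blast
    moreover have "{d. (c, d) \<in> GC P \<and> (d, b) \<in> GC P} \<subset> {d. (a, d) \<in> GC P \<and> (d, b) \<in> GC P}"
      using c GC_irrefl transD[OF trans_GC] by blast
    ultimately have "(a, c) \<in> (hasse_adj P A)\<^sup>*" "(c, b) \<in> (hasse_adj P A)\<^sup>*"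
      using less c \<open>c \<in> A\<close> by (simp_all add: psubset_card_mono)
    then show ?thesis
      by simp
  next
    case False
    then have "(a, b) \<in> hasse_adj P A"
      using less.prems by (auto simp: hasse_adj_def covering_def downset_def)
    then show ?thesis
      by blast
  qed
qed

lemma hasse_adj_mono: "A \<subseteq> B \<Longrightarrow> hasse_adj P A \<subseteq> hasse_adj P B"
  by (auto simp: hasse_adj_def)

lemma hasse_adj_GC: "(a, b) \<in> hasse_adj P A \<Longrightarrow> (a, b) \<in> GC P \<or> (b, a) \<in> GC P"
  by (auto simp: hasse_adj_def covering_def)

lemma sym_hasse_paths: "sym ((hasse_adj P A)\<^sup>*)"
  by (rule sym_rtrancl, rule symI) (auto simp: hasse_adj_def)

lemma hasse_path_in: "(a, b) \<in> (hasse_adj P A)\<^sup>* \<Longrightarrow> a \<in> A \<Longrightarrow> b \<in> A"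
  by (induction rule: rtrancl_induct) (auto simp: hasse_adj_def)

lemma equiv_hasse_paths: "equiv UNIV ((hasse_adj P A)\<^sup>*)"
  by (rule equivI) (simp_all add: refl_rtrancl trans_rtrancl sym_hasse_paths)

lemma Union_components: "\<Union>(components_in P A) = A"
proof
  show "\<Union>(components_in P A) \<subseteq> A"
    using hasse_path_in by (auto simp: components_in_def quotient_def)
  show "A \<subseteq> \<Union>(components_in P A)"
    by (auto simp: components_in_def quotient_def)
qed

lemma finite_components [simp]: "finite (components_in P A)"
proof (rule finite_subset)
  show "components_in P A \<subseteq> Pow A"
    using Union_components by blast
qed simp

lemma components_disjoint:
  "C \<in> components_in P A \<Longrightarrow> D \<in> components_in P A \<Longrightarrow> C \<noteq> D \<Longrightarrow> C \<inter> D = {}"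
  using quotient_disj[OF equiv_hasse_paths, of C A D] by (auto simp: components_in_def quotient_def)

lemma component_connected:
  assumes "C \<in> components_in P A"
  shows "C \<noteq> {}" "connected_in P C"
proof -
  obtain x where x: "x \<in> A" "C = (hasse_adj P A)\<^sup>* `` {x}"
    using assms by (auto simp: components_in_def quotient_def)
  then show "C \<noteq> {}"
    by auto
  have "(x, y) \<in> (hasse_adj P C)\<^sup>*" if "y \<in> C" for y
  proof -
    have "(x, y) \<in> (hasse_adj P A)\<^sup>*"
      using that x by simp
    then show ?thesis
    proof (induction rule: rtrancl_induct)
      case (step y z)
      then have "y \<in> C" "z \<in> C"
        unfolding x(2) by (auto intro: rtrancl_into_rtrancl)
      then have "(y, z) \<in> hasse_adj P C"
        using step(2) by (auto simp: hasse_adj_def)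
      then show ?case
        using step(3) by simp
    qed auto
  qed
  then show "connected_in P C"
    unfolding connected_in_def by (meson rtrancl_trans symD sym_hasse_paths)
qed

text \<open>An element below \<open>b\<close> is joined to \<open>b\<close> by a path inside
  \<open>A\<close>, hence belongs to the same component.\<close>

lemma component_downset:
  assumes "downset (GC P) A" "C \<in> components_in P A"
  shows "downset (GC P) C"
  unfolding downset_def
proof safe
  fix a b assume ab: "(a, b) \<in> GC P" "b \<in> C"
  obtain x where x: "x \<in> A" "C = (hasse_adj P A)\<^sup>* `` {x}"
    using assms(2) by (auto simp: components_in_def quotient_def)
  have "b \<in> A"
    using ab(2) x hasse_path_in by auto
  then have "(a, b) \<in> (hasse_adj P A)\<^sup>*"
    using GC_path ab(1) assms(1) by blast
  then show "a \<in> C"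
    using ab(2) x(2) by (auto intro: rtrancl_trans symD[OF sym_hasse_paths])
qed

lemma components_conn_ideals:
  assumes "A \<in> poset_ideals P"
  shows "components_in P A \<subseteq> conn_ideals P"
proof
  fix C assume C: "C \<in> components_in P A"
  then have "C \<subseteq> A"
    using Union_components by blast
  then have "C \<in> poset_ideals P"
    using assms C component_downset unfolding poset_ideals_iff by blast
  then show "C \<in> conn_ideals P"
    using component_connected[OF C] by (simp add: conn_ideals_def)
qed

lemma components_connected:
  assumes "connected_in P A" "A \<noteq> {}"
  shows "components_in P A = {A}"
proof -
  have "(hasse_adj P A)\<^sup>* `` {x} = A" if "x \<in> A" for x
    using that assms(1) hasse_path_in by (auto simp: connected_in_def)
  then show ?thesis
    using assms(2) by (auto simp: components_in_def quotient_def)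
qed

lemma sum_components: "(\<Sum>C\<in>components_in P A. \<Sum>x\<in>C. g x) = (\<Sum>x\<in>A. g x)"
  using sum.Union_disjoint[of "components_in P A" g] components_disjoint
  by (simp add: Union_components)

lemma sum_card_components: "(\<Sum>C\<in>components_in P A. card C) = card A"
  using sum_components[of "\<lambda>_. 1::nat" A] by simp

text \<open>The components partition \<open>A\<close>, so the indicators of \<open>a\<close> and of
  \<open>opp a\<close> are each counted once.\<close>

lemma sum_chi_components:
  assumes "A \<in> poset_ideals P"
  shows "(\<Sum>C\<in>components_in P A. chi_vec C) = chi_vec A"
proof (rule sval_eqI)
  fix a
  have mem: "(\<Sum>C\<in>components_in P A. of_bool (b \<in> C)) = (of_bool (b \<in> A) :: int)" for b
    using sum_components[of "\<lambda>x. of_bool (x = b) :: int" A] by (simp add: of_bool_def)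
  have "sval (\<Sum>C\<in>components_in P A. chi_vec C) a
      = (\<Sum>C\<in>components_in P A. of_bool (a \<in> C) - of_bool (opp a \<in> C))"
    unfolding sval_sum
    by (intro sum.cong refl sval_chi_ideal)
      (use components_conn_ideals[OF assms] in \<open>auto simp: conn_ideals_def\<close>)
  then show "sval (\<Sum>C\<in>components_in P A. chi_vec C) a = sval (chi_vec A) a"
    by (simp add: sum_subtractf mem sval_chi_ideal assms)
qed

section \<open>Closure properties of the weight cone and of connected sets\<close>

lemma weight_cone_add:
  "rvec f \<in> weight_cone P \<Longrightarrow> rvec g \<in> weight_cone P \<Longrightarrow> rvec (f + g) \<in> weight_cone P"
  unfolding weight_cone_iff by fastforce

lemma weight_cone_zero: "rvec 0 \<in> weight_cone P"
  unfolding weight_cone_iff by simp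

text \<open>In signed coordinates the subtraction is the map \<open>x - sgn x\<close>, which is
  nondecreasing on the integers and so preserves all inequalities of
  \<open>weight_cone_iff\<close>.\<close>

lemma weight_cone_peel:
  assumes "rvec f \<in> weight_cone P"
  shows "rvec (f - chi_vec (supp_pm f)) \<in> weight_cone P"
  using assms unfolding weight_cone_iff
  by (fastforce simp: sval_chi_ideal[OF supp_pm_ideal[OF assms]] mem_supp_pm)

lemma conn_ideal_Un:
  assumes "connected_in P J" "connected_in P K" "J \<inter> K \<noteq> {}"
  shows "connected_in P (J \<union> K)"
proof -
  obtain c where c: "c \<in> J" "c \<in> K"
    using assms(3) by blast
  have "(x, c) \<in> (hasse_adj P (J \<union> K))\<^sup>*" if "x \<in> J \<union> K" for x
    using that assms(1,2) c hasse_adj_mono[of J "J \<union> K"] hasse_adj_mono[of K "J \<union> K"]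
    unfolding connected_in_def by (metis Un_iff Un_upper1 Un_upper2 in_mono rtrancl_mono)
  then show ?thesis
    unfolding connected_in_def by (meson rtrancl_trans symD sym_hasse_paths)
qed

end


section \<open>Polynomials as finitely supported functions\<close>

abbreviation (input) keys where "keys \<equiv> Poly_Mapping.keys"
abbreviation (input) lookup where "lookup \<equiv> Poly_Mapping.lookup"
abbreviation (input) single where "single \<equiv> Poly_Mapping.single"

lemma sum_single_lookup: "(\<Sum>a\<in>keys p. single a (lookup p a)) = p"
proof (rule poly_mapping_eqI)
  fix b
  have "lookup (\<Sum>a\<in>keys p. single a (lookup p a)) b
      = (\<Sum>a\<in>keys p. if a = b then lookup p a else 0)"
    unfolding lookup_sum by (intro sum.cong) (auto simp: lookup_single when_def)
  then show "lookup (\<Sum>a\<in>keys p. single a (lookup p a)) b = lookup p b"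
    by (simp add: in_keys_iff)
qed

text \<open>Pushforward of coefficients, those over one fibre of \<open>g\<close> being added. The
  map \<open>g\<close> is arbitrary because besides the degree it will be the choice of a standard
  monomial, which need not be additive.\<close>

definition push :: "('a \<Rightarrow> 'b) \<Rightarrow> ('a \<Rightarrow>\<^sub>0 'k::comm_monoid_add) \<Rightarrow> ('b \<Rightarrow>\<^sub>0 'k)" where
  "push g p = (\<Sum>a\<in>keys p. single (g a) (lookup p a))"

lemma push_zero [simp]: "push g 0 = 0"
  by (simp add: push_def)

lemma push_single [simp]: "push g (single a c) = single (g a) c"
  by (cases "c = 0") (simp_all add: push_def)

lemma push_add: "push g (p + q) = push g p + push g q"
  unfolding push_def by (rule setsum_keys_plus_distrib) (simp_all add: single_add)

lemma push_sum: "push g (sum F A) = (\<Sum>x\<in>A. push g (F x))"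
  by (induction A rule: infinite_finite_induct) (simp_all add: push_add)

lemma push_push: "push g (push h p) = push (\<lambda>a. g (h a)) p"
proof -
  have "push g (push h p) = push g (\<Sum>a\<in>keys p. single (h a) (lookup p a))"
    by (simp add: push_def)
  also have "\<dots> = push (\<lambda>a. g (h a)) p"
    by (simp add: push_sum) (simp add: push_def)
  finally show ?thesis .
qed

lemma push_mult:
  fixes p q :: "'a::monoid_add \<Rightarrow>\<^sub>0 'k::semiring_0" and g :: "'a \<Rightarrow> 'b::monoid_add"
  assumes "\<And>a b. g (a + b) = g a + g b"
  shows "push g (p * q) = push g p * push g q"
proof -
  have "p * q = (\<Sum>a\<in>keys p. \<Sum>b\<in>keys q. single (a + b) (lookup p a * lookup q b))"
    by (subst (1 2) sum_single_lookup[symmetric]) (simp add: sum_product mult_single)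
  then have "push g (p * q)
      = (\<Sum>a\<in>keys p. \<Sum>b\<in>keys q. single (g a + g b) (lookup p a * lookup q b))"
    by (simp add: push_sum assms)
  then show ?thesis
    by (simp add: push_def sum_product mult_single)
qed

lemma keys_push: "keys (push g p) \<subseteq> g ` keys p"
proof -
  have "keys (push g p) \<subseteq> (\<Union>a\<in>keys p. keys (single (g a) (lookup p a)))"
    unfolding push_def by (rule keys_sum)
  then show ?thesis
    by (auto split: if_splits)
qed

text \<open>One definition covers the degree (\<open>w = chi_vec\<close>), the number of factors
  (\<open>w = 1\<close>) and the weight that controls straightening. Multiplication in
  \<open>int ^ 'n\<close> is componentwise, so \<open>of_nat k * f\<close> is the multiple of
  \<open>f\<close> by \<open>k\<close>.\<close>

definition weighted_sum :: "('v \<Rightarrow> 'a::comm_semiring_1) \<Rightarrow> ('v \<Rightarrow>\<^sub>0 nat) \<Rightarrow> 'a" where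
  "weighted_sum w m = (\<Sum>v\<in>keys m. of_nat (lookup m v) * w v)"

lemma weighted_sum_zero [simp]: "weighted_sum w 0 = 0"
  by (simp add: weighted_sum_def)

lemma weighted_sum_single [simp]: "weighted_sum w (single v k) = of_nat k * w v"
  by (cases "k = 0") (simp_all add: weighted_sum_def)

lemma weighted_sum_add: "weighted_sum w (m + m') = weighted_sum w m + weighted_sum w m'"
  unfolding weighted_sum_def
  by (rule setsum_keys_plus_distrib[where f = "\<lambda>v k. of_nat k * w v"])
    (simp_all add: algebra_simps)

lemma weighted_sum_sum: "weighted_sum w (sum F A) = (\<Sum>x\<in>A. weighted_sum w (F x))"
  by (induction A rule: infinite_finite_induct) (simp_all add: weighted_sum_add)

lemma xmon_power: "xmon f ^ k = (xmon (of_nat k * f) :: _ \<Rightarrow>\<^sub>0 'k::comm_ring_1)"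
  by (induction k) (simp_all add: xmon_def mult_single algebra_simps)

lemma prod_xmon: "(\<Prod>x\<in>A. xmon (g x)) = (xmon (sum g A) :: _ \<Rightarrow>\<^sub>0 'k::comm_ring_1)"
  by (induction A rule: infinite_finite_induct) (simp_all add: xmon_def mult_single)

lemma prod_U:
  "(\<Prod>x\<in>A. U x) = (single (\<Sum>x\<in>A. single x 1) 1 :: _ \<Rightarrow>\<^sub>0 'k::comm_ring_1)"
  by (induction A rule: infinite_finite_induct) (simp_all add: U_def mult_single)

lemma phi_eq_push: "phi p = push (weighted_sum chi_vec) p"
  unfolding phi_def push_def weighted_sum_def xmon_power prod_xmon
  by (simp add: xmon_def const_def mult_single)

lemma phi_add: "phi (p + q) = phi p + phi q"
  by (simp add: phi_eq_push push_add)

lemma phi_mult: "phi (p * q) = phi p * phi q"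
  by (simp add: phi_eq_push push_mult weighted_sum_add)

lemma phi_one: "phi 1 = 1"
  using phi_const[of 1] by (simp add: const_def)

lemma phi_single: "phi (single m c) = single (weighted_sum chi_vec m) c"
  by (simp add: phi_eq_push)

section \<open>Monoid rings of submonoids\<close>

lemma ring_ring_on:
  fixes A :: "'a::comm_ring_1 set"
  assumes "0 \<in> A" "1 \<in> A" "\<And>x y. x \<in> A \<Longrightarrow> y \<in> A \<Longrightarrow> x + y \<in> A"
    "\<And>x y. x \<in> A \<Longrightarrow> y \<in> A \<Longrightarrow> x * y \<in> A" "\<And>x. x \<in> A \<Longrightarrow> - x \<in> A"
  shows "ring (ring_on A)"
proof (rule ringI)
  have "\<exists>y\<in>A. y + x = 0" if "x \<in> A" for x
    using assms(5)[OF that] by (intro bexI[of _ "- x"]) auto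
  then show "abelian_group (ring_on A)"
    by (intro abelian_groupI) (auto simp: ring_on_def assms algebra_simps)
  show "Group.monoid (ring_on A)"
    by (intro monoidI) (auto simp: ring_on_def assms algebra_simps)
qed (auto simp: ring_on_def algebra_simps)

text \<open>Both rings have this form: for the polynomial ring \<open>M\<close> consists of the
  monomials in the allowed variables, for the Laurent side of the lattice points of the weight
  cone.\<close>

lemma ring_supported:
  fixes M :: "'m::comm_monoid_add set"
  assumes "0 \<in> M" "\<And>a b. a \<in> M \<Longrightarrow> b \<in> M \<Longrightarrow> a + b \<in> M"
  shows "ring (ring_on {p :: 'm \<Rightarrow>\<^sub>0 'k::comm_ring_1. keys p \<subseteq> M})"
proof (rule ring_ring_on; clarify)
  fix p q :: "'m \<Rightarrow>\<^sub>0 'k" and a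
  assume pq: "keys p \<subseteq> M" "keys q \<subseteq> M"
  show "a \<in> keys (p + q) \<Longrightarrow> a \<in> M"
    using keys_add[of p q] pq by blast
  assume "a \<in> keys (p * q)"
  then show "a \<in> M"
    using keys_mult[of p q] pq assms(2) by blast
qed (use assms(1) in auto)

lemma polys_in_eq: "polys_in V = {p. keys p \<subseteq> {m. keys m \<subseteq> V}}"
  by (auto simp: polys_in_def)

lemma ring_polys_in: "ring (ring_on (polys_in V :: (_ \<Rightarrow>\<^sub>0 'k::comm_ring_1) set))"
  unfolding polys_in_eq
proof (rule ring_supported)
  fix m m' :: "'a \<Rightarrow>\<^sub>0 nat"
  assume "m \<in> {m. keys m \<subseteq> V}" "m' \<in> {m. keys m \<subseteq> V}"
  then show "m + m' \<in> {m. keys m \<subseteq> V}"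
    using keys_add[of m m'] by blast
qed simp

lemma span_xmon:
  "module.span (\<lambda>c p. const c * p) {xmon f | f. f \<in> M}
    = {p :: (int ^ 'n::finite) \<Rightarrow>\<^sub>0 'k::field. keys p \<subseteq> M}"
proof -
  interpret vector_space "\<lambda>(c::'k) (p :: (int ^ 'n) \<Rightarrow>\<^sub>0 'k). const c * p"
    by (rule vector_space_const)
  have keys_scale: "keys (const c * p) \<subseteq> keys p" for c :: 'k and p :: "(int ^ 'n) \<Rightarrow>\<^sub>0 'k"
    using keys_mult[of "const c" p] by (auto simp: const_def split: if_splits)
  show ?thesis
  proof
    have "subspace {p :: (int ^ 'n) \<Rightarrow>\<^sub>0 'k. keys p \<subseteq> M}"
      unfolding subspace_def
    proof (intro conjI ballI allI; (unfold mem_Collect_eq)?)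
      show "keys (p + q) \<subseteq> M" if "keys p \<subseteq> M" "keys q \<subseteq> M" for p q :: "(int ^ 'n) \<Rightarrow>\<^sub>0 'k"
        using keys_add[of p q] that by blast
      show "keys (const c * p) \<subseteq> M" if "keys p \<subseteq> M" for c :: 'k and p :: "(int ^ 'n) \<Rightarrow>\<^sub>0 'k"
        using keys_scale[of c p] that by blast
    qed simp
    moreover have "{xmon f | f. f \<in> M} \<subseteq> {p :: (int ^ 'n) \<Rightarrow>\<^sub>0 'k. keys p \<subseteq> M}"
      by (auto simp: xmon_def)
    ultimately show "span {xmon f | f. f \<in> M} \<subseteq> {p. keys p \<subseteq> M}"
      by (rule span_minimal[rotated])
    show "{p. keys p \<subseteq> M} \<subseteq> span {xmon f | f. f \<in> M}"
    proof clarify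
      fix p :: "(int ^ 'n) \<Rightarrow>\<^sub>0 'k"
      assume p: "keys p \<subseteq> M"
      have "p = (\<Sum>f\<in>keys p. const (lookup p f) * xmon f)"
        by (subst sum_single_lookup[symmetric]) (simp add: const_def xmon_def mult_single)
      also have "\<dots> \<in> span {xmon f | f. f \<in> M}"
        using p by (intro span_sum span_scale span_base) auto
      finally show "p \<in> span {xmon f | f. f \<in> M}" .
    qed
  qed
qed


section \<open>Standard monomials\<close>

definition standard :: "('n signed set \<Rightarrow>\<^sub>0 nat) \<Rightarrow> bool" where
  "standard m \<longleftrightarrow> (\<forall>J\<in>keys m. \<forall>K\<in>keys m. \<not> nontriv_intersect J K)"

lemma nontriv_intersect_iff:
  "nontriv_intersect J K \<longleftrightarrow>
    (\<exists>a\<in>J. a \<in> K \<or> opp a \<in> K) \<and> \<not> J \<subseteq> K \<and> \<not> K \<subseteq> J"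
proof -
  have "idx ` J \<inter> idx ` K \<noteq> {} \<longleftrightarrow> (\<exists>a\<in>J. \<exists>b\<in>K. idx a = idx b)"
    by (auto simp: disjoint_iff image_iff)
  also have "\<dots> \<longleftrightarrow> (\<exists>a\<in>J. a \<in> K \<or> opp a \<in> K)"
    unfolding idx_eq_iff by (metis opp_opp)
  finally show ?thesis
    by (simp add: nontriv_intersect_def)
qed

context signed_poset_order
begin

lemma sval_degree:
  assumes "keys m \<subseteq> poset_ideals P"
  shows "sval (weighted_sum chi_vec m) a
    = (\<Sum>J\<in>keys m. int (lookup m J) * (of_bool (a \<in> J) - of_bool (opp a \<in> J)))"
  unfolding weighted_sum_def sval_sum sval_of_nat_mult
  using assms by (intro sum.cong) (auto simp: sval_chi_ideal)

text \<open>No cancellation occurs: if \<open>a\<close> and \<open>opp a\<close> lay in two factors,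
  these would be nested, and the larger one would contain an opposite pair.\<close>

lemma standard_degree_pos_iff:
  assumes "standard m" "keys m \<subseteq> poset_ideals P"
  shows "sval (weighted_sum chi_vec m) a > 0 \<longleftrightarrow> (\<exists>J\<in>keys m. a \<in> J)"
proof
  assume "\<exists>J\<in>keys m. a \<in> J"
  then obtain J where J: "J \<in> keys m" "a \<in> J"
    by blast
  have no_opp: "opp a \<notin> K" if "K \<in> keys m" for K
  proof
    assume "opp a \<in> K"
    then have "J \<subseteq> K \<or> K \<subseteq> J"
      using assms(1) J that unfolding standard_def nontriv_intersect_iff by blast
    then show False
      using J \<open>opp a \<in> K\<close> that assms(2) unfolding poset_ideals_iff subset_iff
      by (metis opp_opp poset_ideals_iff)
  qed
  have "0 < int (lookup m J) * (of_bool (a \<in> J) - of_bool (opp a \<in> J))"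
    using J no_opp by (simp add: in_keys_iff)
  then show "sval (weighted_sum chi_vec m) a > 0"
    unfolding sval_degree[OF assms(2)] using J(1) no_opp by (intro sum_pos2[of _ J]) auto
next
  assume pos: "sval (weighted_sum chi_vec m) a > 0"
  show "\<exists>J\<in>keys m. a \<in> J"
  proof (rule ccontr)
    assume "\<not> (\<exists>J\<in>keys m. a \<in> J)"
    then have "sval (weighted_sum chi_vec m) a \<le> 0"
      unfolding sval_degree[OF assms(2)] by (intro sum_nonpos) auto
    then show False
      using pos by simp
  qed
qed

text \<open>Follow a Hasse path in \<open>J\<close> from \<open>a\<close>. A step down stays in
  \<open>K\<close> because \<open>K\<close> is an order ideal. After a step up to \<open>c\<close>,
  a factor \<open>L\<close> containing \<open>c\<close> also contains the previous vertex, so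
  \<open>L\<close> and \<open>K\<close> are nested, and maximality of \<open>K\<close> gives
  \<open>L \<subseteq> K\<close>.\<close>

lemma connected_subset_maximal:
  assumes "standard m" "keys m \<subseteq> poset_ideals P"
    and K: "K \<in> keys m" "\<And>L. L \<in> keys m \<Longrightarrow> K \<subseteq> L \<Longrightarrow> L = K"
    and J: "connected_in P J" "J \<subseteq> \<Union>(keys m)" "a \<in> J" "a \<in> K"
  shows "J \<subseteq> K"
proof
  fix b assume "b \<in> J"
  then have "(a, b) \<in> (hasse_adj P J)\<^sup>*"
    using J by (simp add: connected_in_def)
  then show "b \<in> K"
  proof (induction rule: rtrancl_induct)
    case base
    then show ?case
      by (rule J(4))
  next
    case (step b c)
    have "c \<in> J"
      using step(2) by (auto simp: hasse_adj_def)
    then obtain L where L: "L \<in> keys m" "c \<in> L"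
      using J(2) by blast
    consider "(c, b) \<in> GC P" | "(b, c) \<in> GC P"
      using step(2) hasse_adj_GC by blast
    then show ?case
    proof cases
      case 1
      then show ?thesis
        using step(3) K(1) assms(2) unfolding poset_ideals_iff downset_def subset_iff by blast
    next
      case 2
      then have "b \<in> L"
        using L assms(2) unfolding poset_ideals_iff downset_def subset_iff by blast
      then have "L \<subseteq> K"
        using \<open>standard m\<close> K(1) K(2)[OF L(1)] L(1) step(3)
        unfolding standard_def nontriv_intersect_iff by (metis order_refl)
      then show ?thesis
        using L(2) by blast
    qed
  qed
qed

lemma conn_ideals_subset: "conn_ideals P \<subseteq> poset_ideals P"
  by (auto simp: conn_ideals_def)

text \<open>The maximal members of a standard monomial are the connected components of the positive
  support of its degree, so they can be read off from the degree.\<close>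

lemma standard_unique:
  assumes "standard m" "keys m \<subseteq> conn_ideals P" "standard m'" "keys m' \<subseteq> conn_ideals P"
    and "weighted_sum chi_vec m = weighted_sum chi_vec m'"
  shows "m = m'"
  using assms
proof (induction "weighted_sum (\<lambda>_. 1::nat) m" arbitrary: m m' rule: less_induct)
  case less
  have ideals: "keys m \<subseteq> poset_ideals P" "keys m' \<subseteq> poset_ideals P"
    using less.prems conn_ideals_subset by auto
  \<comment> \<open>Both unions are the set of indices at which the common degree is
    positive.\<close>
  have Un: "\<Union>(keys m) = \<Union>(keys m')"
    unfolding set_eq_iff Union_iff
      standard_degree_pos_iff[OF less.prems(1) ideals(1), symmetric]
      standard_degree_pos_iff[OF less.prems(3) ideals(2), symmetric] less.prems(5) by simp
  have nonempty: "J \<noteq> {}" if "J \<in> keys m \<union> keys m'" for J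
    using that less.prems by (auto simp: conn_ideals_def)
  show ?case
  proof (cases "keys m = {}")
    case True
    then have "keys m' = {}"
      using Un nonempty by fastforce
    then show ?thesis
      using True by (metis keys_eq_empty)
  next
    case False
    obtain J where J: "J \<in> keys m" "\<And>L. L \<in> keys m \<Longrightarrow> J \<subseteq> L \<Longrightarrow> L = J"
      using finite_has_maximal[OF finite_keys False] by metis
    obtain a where a: "a \<in> J"
      using nonempty J(1) by blast
    then have "a \<in> \<Union>(keys m')"
      using J(1) by (auto simp flip: Un)
    then obtain K\<^sub>0 where K\<^sub>0: "K\<^sub>0 \<in> keys m'" "a \<in> K\<^sub>0"
      by blast
    obtain K where K: "K \<in> keys m'" "K\<^sub>0 \<subseteq> K" "\<And>L. L \<in> keys m' \<Longrightarrow> K \<subseteq> L \<Longrightarrow> L = K"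
      using finite_has_maximal2[OF finite_keys K\<^sub>0(1)] by metis
    \<comment> \<open>The two maximal ideals share \<open>a\<close>, and each is connected and
      covered by the factors of the other monomial; hence each lies in the other.\<close>
    have "connected_in P J" "connected_in P K"
      using J(1) K(1) less.prems by (auto simp: conn_ideals_def)
    moreover have "a \<in> K"
      using K\<^sub>0(2) K(2) by blast
    moreover have "J \<subseteq> \<Union>(keys m')" "K \<subseteq> \<Union>(keys m)"
      using J(1) K(1) Un by auto
    ultimately have "J \<subseteq> K" "K \<subseteq> J"
      using connected_subset_maximal[OF less.prems(3) ideals(2) K(1,3), of J a]
        connected_subset_maximal[OF less.prems(1) ideals(1) J, of K a] a by simp_all
    then have "J \<in> keys m'"
      using K(1) by simp
    \<comment> \<open>One copy of the common factor \<open>J\<close> is cancelled, which lowers the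
      number of factors by one.\<close>
    define r r' where "r = m - single J 1" and "r' = m' - single J 1"
    have m: "m = r + single J 1"
      using J(1) unfolding r_def
      by (intro poly_mapping_eqI) (auto simp: lookup_add lookup_minus lookup_single when_def in_keys_iff)
    have m': "m' = r' + single J 1"
      using \<open>J \<in> keys m'\<close> unfolding r'_def
      by (intro poly_mapping_eqI) (auto simp: lookup_add lookup_minus lookup_single when_def in_keys_iff)
    have sub: "keys r \<subseteq> keys m" "keys r' \<subseteq> keys m'"
      unfolding r_def r'_def by (auto simp: in_keys_iff lookup_minus)
    have "r = r'"
    proof (rule less.hyps)
      show "weighted_sum (\<lambda>_. 1) r < weighted_sum (\<lambda>_. 1::nat) m"
        unfolding m by (simp add: weighted_sum_add)
      show "weighted_sum chi_vec r = weighted_sum chi_vec r'"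
        using less.prems(5) unfolding m m' by (simp add: weighted_sum_add)
      show "standard r" "standard r'"
        using less.prems(1,3) sub unfolding standard_def by blast+
      show "keys r \<subseteq> conn_ideals P" "keys r' \<subseteq> conn_ideals P"
        using less.prems(2,4) sub by blast+
    qed
    then show ?thesis
      using m m' by simp
  qed
qed

text \<open>Each peeling lowers every positive signed coordinate by one, so their sum bounds the
  recursion. The ideal peeled off need not be connected; its vector is the sum of those of its
  components.\<close>

lemma exists_monomial_of_degree:
  assumes "rvec f \<in> weight_cone P"
  obtains m where "keys m \<subseteq> conn_ideals P" "weighted_sum chi_vec m = f"
proof -
  have "\<exists>m. keys m \<subseteq> conn_ideals P \<and> weighted_sum chi_vec m = f"
    using assms
  proof (induction "\<Sum>a\<in>supp_pm f. nat (sval f a)" arbitrary: f rule: less_induct)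
    case less
    let ?A = "supp_pm f" and ?g = "f - chi_vec (supp_pm f)"
    have A: "?A \<in> poset_ideals P"
      using less.prems by (rule supp_pm_ideal)
    show ?case
    proof (cases "?A = {}")
      case True
      have "f = 0"
      proof (rule sval_eqI)
        fix a
        have "\<not> sval f a > 0" "\<not> sval f (opp a) > 0"
          using True unfolding mem_supp_pm[symmetric] by auto
        then show "sval f a = sval 0 a"
          by simp
      qed
      then show ?thesis
        by (intro exI[of _ 0]) simp
    next
      case False
      have g: "sval ?g a = sval f a - 1" if "a \<in> ?A" for a
        using that by (simp add: sval_chi_ideal[OF A] mem_supp_pm)
      have sub: "supp_pm ?g \<subseteq> ?A"
        by (auto simp: mem_supp_pm sval_chi_ideal[OF A] of_bool_def split: if_splits)
      have "(\<Sum>a\<in>supp_pm ?g. nat (sval ?g a)) \<le> (\<Sum>a\<in>?A. nat (sval ?g a))"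
        using sub by (intro sum_mono2) auto
      also have "\<dots> < (\<Sum>a\<in>?A. nat (sval f a))"
        using False g by (intro sum_strict_mono) (auto simp: mem_supp_pm)
      finally obtain m where m: "keys m \<subseteq> conn_ideals P" "weighted_sum chi_vec m = ?g"
        using less.hyps weight_cone_peel[OF less.prems] by blast
      let ?c = "\<Sum>C\<in>components_in P ?A. single C (1::nat)"
      have "keys ?c \<subseteq> conn_ideals P"
        using keys_sum[of "\<lambda>C. single C (1::nat)" "components_in P ?A"] components_conn_ideals[OF A]
        by auto
      then have "keys (m + ?c) \<subseteq> conn_ideals P"
        using m(1) keys_add[of m ?c] by blast
      moreover have "weighted_sum chi_vec (m + ?c) = f"
        by (simp add: weighted_sum_add weighted_sum_sum m(2) sum_chi_components[OF A])
      ultimately show ?thesis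
        by blast
    qed
  qed
  then show ?thesis
    using that by blast
qed

end


section \<open>Straightening\<close>

text \<open>Straightening a pair \<open>J, K\<close> lowers \<open>\<Sum> (B |J| - 2 ^ |J|)\<close>, where \<open>B\<close> is twice the largest
  possible value of \<open>2 ^ |J|\<close>: if the two ideals contain opposite elements, then the total size
  drops by at least \<open>2\<close>; otherwise the total size is kept and \<open>2 ^ |J \<union> K| \<ge> 2 ^ |J| + 2 ^ |K|\<close>.\<close>

definition straightening_weight :: "'n::finite signed set \<Rightarrow> int" where
  "straightening_weight J = 2 * 2 ^ CARD('n signed) * int (card J) - 2 ^ card J"

lemma two_power_card_le: "(2::int) ^ card (J :: 'n::finite signed set) \<le> 2 ^ CARD('n signed)"
  by (intro power_increasing card_mono) auto

text \<open>A single element already contributes \<open>2 * 2 ^ CARD('n signed)\<close>, which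
  exceeds \<open>2 ^ card J\<close>. The empty set is excluded since its weight is -1.\<close>

lemma straightening_weight_nonneg:
  assumes "J \<noteq> {}"
  shows "straightening_weight (J :: 'n::finite signed set) \<ge> 0"
proof -
  have "1 \<le> int (card J)"
    using assms by (simp add: Suc_le_eq card_gt_0_iff)
  then have "2 * 2 ^ CARD('n signed) * 1 \<le> 2 * 2 ^ CARD('n signed) * int (card J)"
    by (intro mult_left_mono) auto
  then show ?thesis
    using two_power_card_le[of J] zero_le_power[of "2::int" "CARD('n signed)"]
    unfolding straightening_weight_def by linarith
qed

context signed_poset_order
begin

text \<open>The linear part of the weight does not see how \<open>A\<close> splits into components;
  only the exponential part does.\<close>

lemma sum_straightening_weight:
  "(\<Sum>C\<in>components_in P A. straightening_weight C)
    = 2 * 2 ^ CARD('n signed) * int (card A) - (\<Sum>C\<in>components_in P A. 2 ^ card C)"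
proof -
  have "(\<Sum>C\<in>components_in P A. int (card C)) = int (card A)"
    by (simp flip: of_nat_sum add: sum_card_components)
  then show ?thesis
    by (simp add: straightening_weight_def sum_subtractf flip: sum_distrib_left)
qed

lemma mem_supp_chi_add:
  assumes "J \<in> poset_ideals P" "K \<in> poset_ideals P"
  shows "a \<in> supp_pm (chi_vec J + chi_vec K) \<longleftrightarrow> a \<in> J \<union> K \<and> opp a \<notin> J \<union> K"
proof -
  have "\<not> (a \<in> J \<and> opp a \<in> J)" "\<not> (a \<in> K \<and> opp a \<in> K)"
    using assms by (auto simp: poset_ideals_iff)
  then show ?thesis
    by (auto simp: mem_supp_pm sval_chi_ideal assms of_bool_def split: if_splits)
qed

lemma chi_add_ideal:
  assumes "J \<in> poset_ideals P" "K \<in> poset_ideals P"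
  shows "supp_pm (chi_vec J + chi_vec K) \<in> poset_ideals P"
  by (intro supp_pm_ideal weight_cone_add ideal_weight_cone assms)

text \<open>At a common element both sides are 2 = 1 + 1, since the intersection lies in the support
  of the sum. An index in just one ideal whose opposite is in neither gives 1 through the support
  alone, and an index in one with its opposite in the other contributes to neither term.\<close>

lemma chi_add_straighten:
  assumes "J \<in> poset_ideals P" "K \<in> poset_ideals P"
  shows "chi_vec J + chi_vec K = chi_vec (J \<inter> K) + chi_vec (supp_pm (chi_vec J + chi_vec K))"
proof (rule sval_eqI)
  fix a
  have "\<not> (a \<in> J \<and> opp a \<in> J)" "\<not> (a \<in> K \<and> opp a \<in> K)"
    using assms by (auto simp: poset_ideals_iff)
  then show "sval (chi_vec J + chi_vec K) a
      = sval (chi_vec (J \<inter> K) + chi_vec (supp_pm (chi_vec J + chi_vec K))) a"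
    by (simp add: sval_chi_ideal ideal_Int chi_add_ideal mem_supp_chi_add assms)
qed

lemma straightening_weight_less:
  assumes J: "J \<in> conn_ideals P" and K: "K \<in> conn_ideals P" and JK: "nontriv_intersect J K"
  shows "(\<Sum>C\<in>components_in P (J \<inter> K). straightening_weight C)
      + (\<Sum>C\<in>components_in P (supp_pm (chi_vec J + chi_vec K)). straightening_weight C)
    < straightening_weight J + straightening_weight K"
proof -
  let ?S = "supp_pm (chi_vec J + chi_vec K)" and ?B = "2 * 2 ^ CARD('n signed) :: int"
  have ideals: "J \<in> poset_ideals P" "K \<in> poset_ideals P"
    using J K by (auto simp: conn_ideals_def)
  have card: "int (card J) + int (card K) = int (card (J \<union> K)) + int (card (J \<inter> K))"
    using card_Un_Int[of J K] by simp
  have bounds: "(2::int) ^ card J \<le> 2 ^ CARD('n signed)" "(2::int) ^ card K \<le> 2 ^ CARD('n signed)"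
    by (rule two_power_card_le)+
  have nonneg: "(\<Sum>C\<in>components_in P A. (2::int) ^ card C) \<ge> 0" for A
    by (intro sum_nonneg) auto
  show ?thesis
  proof (cases "\<exists>a\<in>J. opp a \<in> K")
    case True
    then obtain a where a: "a \<in> J" "opp a \<in> K"
      by blast
    \<comment> \<open>Both members of the opposite pair belong to the union and both cancel, hence a
      loss of two elements.\<close>
    have "?S \<subseteq> (J \<union> K) - {a, opp a}"
      using a by (auto simp: mem_supp_chi_add ideals)
    then have "card ?S \<le> card ((J \<union> K) - {a, opp a})"
      by (intro card_mono) auto
    moreover have "card ((J \<union> K) - {a, opp a}) + 2 = card (J \<union> K)"
    proof -
      have "card {a, opp a} = 2"
        by simp
      moreover have "{a, opp a} \<subseteq> J \<union> K"
        using a by auto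
      ultimately show ?thesis
        using card_mono[of "J \<union> K" "{a, opp a}"] card_Diff_subset[of "{a, opp a}" "J \<union> K"] by simp
    qed
    ultimately have "int (card (J \<inter> K)) + int (card ?S) \<le> int (card J) + int (card K) - 2"
      using card by linarith
    then have "?B * (int (card (J \<inter> K)) + int (card ?S)) \<le> ?B * (int (card J) + int (card K) - 2)"
      by (intro mult_left_mono) auto
    moreover have "(0::int) < 2 ^ CARD('n signed)"
      by simp
    \<comment> \<open>The linear part falls by at least \<open>2 * ?B\<close>, whereas the terms
      \<open>2 ^ card J\<close> and \<open>2 ^ card K\<close> together are at most
      \<open>?B\<close>.\<close>
    ultimately show ?thesis
      using bounds nonneg[of "J \<inter> K"] nonneg[of ?S]
      unfolding sum_straightening_weight unfolding straightening_weight_def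
      by (simp only: distrib_left right_diff_distrib)
  next
    case False
    have no_opp: "opp a \<notin> J \<union> K" if "a \<in> J \<union> K" for a
      using that False ideals unfolding poset_ideals_iff by (metis Un_iff opp_opp)
    then have S: "?S = J \<union> K"
      by (auto simp: mem_supp_chi_add ideals)
    have ne: "J \<inter> K \<noteq> {}" and sub: "\<not> J \<subseteq> K" "\<not> K \<subseteq> J"
      using JK False unfolding nontriv_intersect_iff by auto
    have "card J < card (J \<union> K)" "card K < card (J \<union> K)"
      using sub by (auto intro!: psubset_card_mono)
    \<comment> \<open>Averaging the two bounds gives
      \<open>2 ^ card J + 2 ^ card K \<le> 2 ^ card (J \<union> K)\<close>.\<close>
    then have "(2::int) ^ Suc (card J) \<le> 2 ^ card (J \<union> K)" "(2::int) ^ Suc (card K) \<le> 2 ^ card (J \<union> K)"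
      by (intro power_increasing; simp)+
    moreover have "components_in P (J \<union> K) = {J \<union> K}"
      using J K ne by (intro components_connected conn_ideal_Un) (auto simp: conn_ideals_def)
    moreover have "components_in P (J \<inter> K) \<noteq> {}"
      using ne Union_components[of "J \<inter> K"] by auto
    \<comment> \<open>Strictness comes from here: for \<open>card J = card K\<close> with one
      element of each outside the other, the averaged bound alone can be an equality.\<close>
    then have "(0::int) < (\<Sum>C\<in>components_in P (J \<inter> K). 2 ^ card C)"
      by (intro sum_pos) auto
    moreover have "?B * int (card (J \<inter> K)) + ?B * int (card (J \<union> K))
        = ?B * int (card J) + ?B * int (card K)"
      using card by (simp flip: distrib_left)
    ultimately show ?thesis
      unfolding S sum_straightening_weight unfolding straightening_weight_def by simp
  qed
qed

section \<open>Syzygies and the ideal they generate\<close>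

lemma Pi_pairs_iff:
  "{J, K} \<in> Pi_pairs P \<longleftrightarrow> J \<in> conn_ideals P \<and> K \<in> conn_ideals P \<and> nontriv_intersect J K"
  by (auto simp: Pi_pairs_def doubleton_eq_iff nontriv_intersect_def)

lemma ring_S_wt: "ring (S_wt P :: (_ \<Rightarrow>\<^sub>0 'k::field) ring)"
  unfolding S_wt_def by (rule ring_polys_in)

lemma carrier_S_wt: "carrier (S_wt P :: (_ \<Rightarrow>\<^sub>0 'k::field) ring) = polys_in (conn_ideals P)"
  by (simp add: S_wt_def ring_on_def)

lemma single_in_S_wt: "keys m \<subseteq> conn_ideals P \<Longrightarrow> single m c \<in> polys_in (conn_ideals P)"
  by (simp add: polys_in_def)

text \<open>The exponent of the second term of the syzygy. A component can occur in both sums and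
  then has exponent 2: for roots \<open>e1 - e2\<close>, \<open>e1 + e2\<close>, \<open>e1\<close>
  and the ideals \<open>{1, 2}\<close>, \<open>{1, -2}\<close>, both the intersection and the
  support of the sum are \<open>{1}\<close>.\<close>

definition straightened :: "'n signed set \<Rightarrow> 'n signed set \<Rightarrow> ('n signed set \<Rightarrow>\<^sub>0 nat)" where
  "straightened J K = (\<Sum>C\<in>components_in P (J \<inter> K). single C 1)
    + (\<Sum>C\<in>components_in P (supp_pm (chi_vec J + chi_vec K)). single C 1)"

lemma syz_eq:
  "syz P J K = (single (single J 1 + single K 1) 1 - single (straightened J K) 1
    :: _ \<Rightarrow>\<^sub>0 'k::field)"
  unfolding syz_def prod_U straightened_def by (simp add: U_def mult_single)

lemma keys_straightened:
  assumes "J \<in> poset_ideals P" "K \<in> poset_ideals P"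
  shows "keys (straightened J K) \<subseteq> conn_ideals P"
proof -
  have sub: "keys (\<Sum>C\<in>components_in P A. single C (1::nat)) \<subseteq> conn_ideals P"
    if "A \<in> poset_ideals P" for A
    using keys_sum[of "\<lambda>C. single C (1::nat)" "components_in P A"] components_conn_ideals[OF that]
    by auto
  show ?thesis
    unfolding straightened_def
    by (intro order.trans[OF keys_add] Un_least sub ideal_Int chi_add_ideal assms)
qed

lemma degree_straightened:
  assumes "J \<in> poset_ideals P" "K \<in> poset_ideals P"
  shows "weighted_sum chi_vec (straightened J K) = chi_vec J + chi_vec K"
  using assms chi_add_straighten[OF assms]
  by (simp add: straightened_def weighted_sum_add weighted_sum_sum sum_chi_components ideal_Int
      chi_add_ideal)

lemma syz_in_S_wt:
  assumes "J \<in> conn_ideals P" "K \<in> conn_ideals P"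
  shows "(syz P J K :: _ \<Rightarrow>\<^sub>0 'k::field) \<in> polys_in (conn_ideals P)"
proof -
  have "keys (syz P J K :: _ \<Rightarrow>\<^sub>0 'k) \<subseteq> {single J 1 + single K 1, straightened J K}"
    unfolding syz_eq by (rule order.trans[OF keys_diff]) simp
  moreover have "keys (single J 1 + single K (1::nat)) \<subseteq> conn_ideals P"
    using keys_add[of "single J (1::nat)" "single K 1"] assms by auto
  moreover have "keys (straightened J K) \<subseteq> conn_ideals P"
    using assms conn_ideals_subset by (intro keys_straightened) auto
  ultimately show ?thesis
    unfolding polys_in_def by auto
qed

lemma phi_syz:
  assumes "J \<in> conn_ideals P" "K \<in> conn_ideals P"
  shows "phi (syz P J K :: _ \<Rightarrow>\<^sub>0 'k::field) = 0"
proof -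
  have "weighted_sum chi_vec (straightened J K) = chi_vec J + chi_vec K"
    using assms conn_ideals_subset by (intro degree_straightened) auto
  moreover have "phi (p - q) = phi p - phi q" for p q :: "('n signed set \<Rightarrow>\<^sub>0 nat) \<Rightarrow>\<^sub>0 'k"
    using phi_add[of "p - q" q] by (simp add: algebra_simps)
  ultimately show ?thesis
    by (simp add: syz_eq phi_single weighted_sum_add)
qed

lemma ideal_I_wt: "ideal (I_wt P :: (_ \<Rightarrow>\<^sub>0 'k::field) set) (S_wt P)"
  unfolding I_wt_def
  using syz_in_S_wt by (intro ring.genideal_ideal ring_S_wt) (auto simp: carrier_S_wt Pi_pairs_iff)

lemma syz_in_I_wt:
  assumes "J \<in> conn_ideals P" "K \<in> conn_ideals P" "nontriv_intersect J K"
  shows "(syz P J K :: _ \<Rightarrow>\<^sub>0 'k::field) \<in> I_wt P"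
  unfolding I_wt_def genideal_def using assms Pi_pairs_iff by blast

lemma I_wt_zero: "(0 :: _ \<Rightarrow>\<^sub>0 'k::field) \<in> I_wt P"
  using additive_subgroup.zero_closed[OF ideal.axioms(1)[OF ideal_I_wt]]
  by (simp add: S_wt_def ring_on_def)

lemma I_wt_add:
  "p \<in> I_wt P \<Longrightarrow> q \<in> I_wt P \<Longrightarrow> p + q \<in> (I_wt P :: (_ \<Rightarrow>\<^sub>0 'k::field) set)"
  using additive_subgroup.a_closed[OF ideal.axioms(1)[OF ideal_I_wt], of p q]
  by (simp add: S_wt_def ring_on_def)

lemma I_wt_mult:
  "p \<in> polys_in (conn_ideals P) \<Longrightarrow> q \<in> I_wt P \<Longrightarrow> p * q \<in> (I_wt P :: (_ \<Rightarrow>\<^sub>0 'k::field) set)"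
  using ideal.I_l_closed[OF ideal_I_wt, of q p]
  by (simp add: S_wt_def ring_on_def)

lemma I_wt_sum:
  "(\<And>x. x \<in> A \<Longrightarrow> F x \<in> I_wt P) \<Longrightarrow> sum F A \<in> (I_wt P :: (_ \<Rightarrow>\<^sub>0 'k::field) set)"
  by (induction A rule: infinite_finite_induct) (auto intro: I_wt_zero I_wt_add)

text \<open>Rewriting one offending pair lowers the weight and changes the monomial by a multiple of
  a syzygy. The congruence is stated for every coefficient \<open>c\<close> so that a polynomial can
  be reduced term by term.\<close>

lemma exists_standard:
  assumes "keys m \<subseteq> conn_ideals P"
  obtains m' where "keys m' \<subseteq> conn_ideals P" "standard m'"
    "weighted_sum chi_vec m' = weighted_sum chi_vec m"
    "\<And>c. (single m c - single m' c :: _ \<Rightarrow>\<^sub>0 'k::field) \<in> I_wt P"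
proof -
  have "\<exists>m'. keys m' \<subseteq> conn_ideals P \<and> standard m' \<and> weighted_sum chi_vec m' = weighted_sum chi_vec m \<and>
      (\<forall>c. (single m c - single m' c :: _ \<Rightarrow>\<^sub>0 'k) \<in> I_wt P)"
    using assms
  proof (induction "nat (weighted_sum straightening_weight m)" arbitrary: m rule: less_induct)
    case less
    show ?case
    proof (cases "standard m")
      case True
      then show ?thesis
        using less.prems I_wt_zero by (intro exI[of _ m]) simp
    next
      case False
      then obtain J K where JK: "J \<in> keys m" "K \<in> keys m" "nontriv_intersect J K"
        by (auto simp: standard_def)
      then have conn: "J \<in> conn_ideals P" "K \<in> conn_ideals P"
        using less.prems by auto
      then have ideals: "J \<in> poset_ideals P" "K \<in> poset_ideals P"
        using conn_ideals_subset by auto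
      have "J \<noteq> K"
        using JK(3) by (auto simp: nontriv_intersect_def)
      define r where "r = m - (single J 1 + single K 1)"
      \<comment> \<open>Subtraction of exponents is truncated; it is exact here because
        \<open>J\<close> and \<open>K\<close> are different variables, both with positive
        exponent.\<close>
      have m: "m = single J 1 + single K 1 + r"
        using JK(1,2) \<open>J \<noteq> K\<close> unfolding r_def
        by (intro poly_mapping_eqI)
          (auto simp: lookup_add lookup_minus lookup_single when_def in_keys_iff)
      have "keys r \<subseteq> keys m"
        unfolding r_def by (auto simp: in_keys_iff lookup_minus)
      then have r: "keys r \<subseteq> conn_ideals P"
        using less.prems by blast
      define m\<^sub>1 where "m\<^sub>1 = straightened J K + r"
      have m\<^sub>1: "keys m\<^sub>1 \<subseteq> conn_ideals P"
        using keys_add[of "straightened J K" r] keys_straightened[OF ideals] r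
        unfolding m\<^sub>1_def by blast
      \<comment> \<open>The weight is an integer and the induction runs over its \<open>nat\<close>,
        so strict descent has to be secured against truncation at 0.\<close>
      have nonneg: "weighted_sum straightening_weight m\<^sub>1 \<ge> 0"
        unfolding weighted_sum_def using m\<^sub>1
        by (intro sum_nonneg mult_nonneg_nonneg straightening_weight_nonneg)
          (auto simp: conn_ideals_def)
      have "weighted_sum straightening_weight m\<^sub>1 < weighted_sum straightening_weight m"
        using straightening_weight_less[OF conn JK(3)]
        unfolding m m\<^sub>1_def straightened_def by (simp add: weighted_sum_add weighted_sum_sum)
      then have "nat (weighted_sum straightening_weight m\<^sub>1) < nat (weighted_sum straightening_weight m)"
        using nonneg by simp
      then obtain m' where m': "keys m' \<subseteq> conn_ideals P" "standard m'"
        "weighted_sum chi_vec m' = weighted_sum chi_vec m\<^sub>1"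
        "\<And>c. (single m\<^sub>1 c - single m' c :: _ \<Rightarrow>\<^sub>0 'k) \<in> I_wt P"
        using less.hyps m\<^sub>1 by blast
      have "weighted_sum chi_vec m\<^sub>1 = weighted_sum chi_vec m"
        unfolding m m\<^sub>1_def by (simp add: weighted_sum_add degree_straightened[OF ideals])
      moreover have "(single m c - single m' c :: _ \<Rightarrow>\<^sub>0 'k) \<in> I_wt P" for c
      proof -
        have "single m c - single m\<^sub>1 c = single r c * (syz P J K :: _ \<Rightarrow>\<^sub>0 'k)"
          unfolding m m\<^sub>1_def syz_eq by (simp add: algebra_simps mult_single)
        also have "\<dots> \<in> I_wt P"
          by (intro I_wt_mult single_in_S_wt r syz_in_I_wt conn JK(3))
        finally have "(single m c - single m\<^sub>1 c) + (single m\<^sub>1 c - single m' c :: _ \<Rightarrow>\<^sub>0 'k) \<in> I_wt P"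
          using m'(4) I_wt_add by blast
        then show ?thesis
          by simp
      qed
      ultimately show ?thesis
        using m' by metis
    qed
  qed
  then show ?thesis
    using that by blast
qed

lemma kernel_subset_I_wt:
  fixes p :: "('n signed set \<Rightarrow>\<^sub>0 nat) \<Rightarrow>\<^sub>0 'k::field"
  assumes "p \<in> polys_in (conn_ideals P)" "phi p = 0"
  shows "p \<in> I_wt P"
proof -
  \<comment> \<open>The choice is arbitrary at vectors that are not degrees; it is evaluated only at
    degrees of monomials of \<open>p\<close>.\<close>
  define N where "N f = (SOME m. keys m \<subseteq> conn_ideals P \<and> standard m \<and> weighted_sum chi_vec m = f)"
    for f
  have N: "single m c - single (N (weighted_sum chi_vec m)) c \<in> (I_wt P :: (_ \<Rightarrow>\<^sub>0 'k) set)"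
    if "m \<in> keys p" for m c
  proof -
    have "keys m \<subseteq> conn_ideals P"
      using assms(1) that by (auto simp: polys_in_def)
    then obtain m' where m': "keys m' \<subseteq> conn_ideals P" "standard m'"
      "weighted_sum chi_vec m' = weighted_sum chi_vec m"
      "single m c - single m' c \<in> (I_wt P :: (_ \<Rightarrow>\<^sub>0 'k) set)"
      using exists_standard by metis
    \<comment> \<open>Uniqueness of the standard monomial identifies the chosen one with the result
      of straightening \<open>m\<close>.\<close>
    have "N (weighted_sum chi_vec m) = m'"
      unfolding N_def by (rule some_equality) (use m' standard_unique in auto)
    then show ?thesis
      using m'(4) by simp
  qed
  have "(\<Sum>m\<in>keys p. single m (lookup p m) - single (N (weighted_sum chi_vec m)) (lookup p m)) \<in> I_wt P"
    by (intro I_wt_sum N)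
  then have "p - push (\<lambda>m. N (weighted_sum chi_vec m)) p \<in> I_wt P"
    by (simp add: sum_subtractf sum_single_lookup push_def)
  \<comment> \<open>The standard form factors through the degree, so the reduced polynomial depends
    on \<open>phi p\<close> only and vanishes with it.\<close>
  moreover have "push (\<lambda>m. N (weighted_sum chi_vec m)) p = push N (phi p)"
    by (simp add: phi_eq_push push_push)
  ultimately show ?thesis
    using assms(2) by simp
qed

section \<open>Image and kernel of the toric map\<close>

lemma R_wt_eq:
  "(R_wt P :: (_ \<Rightarrow>\<^sub>0 'k::field) ring) = ring_on {p. keys p \<subseteq> {f. rvec f \<in> weight_cone P}}"
  using span_xmon[where 'k = 'k, of "{f. rvec f \<in> weight_cone P}"] by (simp add: R_wt_def)

lemma carrier_R_wt:
  "carrier (R_wt P :: (_ \<Rightarrow>\<^sub>0 'k::field) ring) = {p. keys p \<subseteq> {f. rvec f \<in> weight_cone P}}"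
  by (simp add: R_wt_eq ring_on_def)

lemma ring_R_wt: "ring (R_wt P :: (_ \<Rightarrow>\<^sub>0 'k::field) ring)"
  unfolding R_wt_eq by (rule ring_supported) (simp_all add: weight_cone_zero weight_cone_add)

lemma degree_in_weight_cone:
  assumes "keys m \<subseteq> conn_ideals P"
  shows "rvec (weighted_sum chi_vec m) \<in> weight_cone P"
proof -
  have multiple: "rvec (of_nat k * f) \<in> weight_cone P" if "rvec f \<in> weight_cone P" for k f
    using that by (induction k) (simp_all add: weight_cone_zero weight_cone_add algebra_simps)
  have "rvec (sum F A) \<in> weight_cone P" if "\<And>x. x \<in> A \<Longrightarrow> rvec (F x) \<in> weight_cone P"
    for F and A :: "'n signed set set"
    using that by (induction A rule: infinite_finite_induct)
      (auto simp: weight_cone_zero intro: weight_cone_add)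
  then show ?thesis
    unfolding weighted_sum_def using assms conn_ideals_subset
    by (meson ideal_weight_cone multiple subsetD)
qed

lemma phi_image:
  "phi ` polys_in (conn_ideals P)
    = {p :: _ \<Rightarrow>\<^sub>0 'k::field. keys p \<subseteq> {f. rvec f \<in> weight_cone P}}"
proof
  show "phi ` polys_in (conn_ideals P)
      \<subseteq> {p :: _ \<Rightarrow>\<^sub>0 'k. keys p \<subseteq> {f. rvec f \<in> weight_cone P}}"
  proof clarify
    fix p :: "('n signed set \<Rightarrow>\<^sub>0 nat) \<Rightarrow>\<^sub>0 'k" and f
    assume "p \<in> polys_in (conn_ideals P)" "f \<in> keys (phi p)"
    then show "rvec f \<in> weight_cone P"
      using keys_push[of "weighted_sum chi_vec" p] degree_in_weight_cone
      by (auto simp: phi_eq_push polys_in_def)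
  qed
  show "{p :: _ \<Rightarrow>\<^sub>0 'k. keys p \<subseteq> {f. rvec f \<in> weight_cone P}} \<subseteq> phi ` polys_in (conn_ideals P)"
  proof clarify
    fix q :: "(int ^ 'n) \<Rightarrow>\<^sub>0 'k"
    assume q: "keys q \<subseteq> {f. rvec f \<in> weight_cone P}"
    then have "\<forall>f\<in>keys q. \<exists>m. keys m \<subseteq> conn_ideals P \<and> weighted_sum chi_vec m = f"
      using exists_monomial_of_degree by (metis mem_Collect_eq subsetD)
    \<comment> \<open>A choice of one monomial above each exponent of \<open>q\<close>; pushing
      \<open>q\<close> forward along it gives a preimage, whether or not these monomials are
      standard.\<close>
    then obtain M where M: "\<And>f. f \<in> keys q \<Longrightarrow> keys (M f) \<subseteq> conn_ideals P"
      "\<And>f. f \<in> keys q \<Longrightarrow> weighted_sum chi_vec (M f) = f"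
      by metis
    have "phi (push M q) = push (\<lambda>f. weighted_sum chi_vec (M f)) q"
      by (simp add: phi_eq_push push_push)
    also have "\<dots> = (\<Sum>f\<in>keys q. single f (lookup q f))"
      unfolding push_def using M(2) by (intro sum.cong) auto
    finally have "phi (push M q) = q"
      by (simp add: sum_single_lookup)
    moreover have "push M q \<in> polys_in (conn_ideals P)"
      using keys_push[of M q] M(1) by (fastforce simp: polys_in_def)
    ultimately show "q \<in> phi ` polys_in (conn_ideals P)"
      by (metis imageI)
  qed
qed

lemma ring_hom_phi: "ring_hom_ring (S_wt P) (R_wt P :: (_ \<Rightarrow>\<^sub>0 'k::field) ring) phi"
proof (rule ring_hom_ringI)
  show "phi p \<in> carrier (R_wt P :: (_ \<Rightarrow>\<^sub>0 'k) ring)" if "p \<in> carrier (S_wt P)" for p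
    using that phi_image unfolding carrier_S_wt carrier_R_wt by blast
qed (simp_all add: ring_S_wt ring_R_wt, simp_all add: S_wt_def R_wt_def ring_on_def phi_add phi_mult
  phi_one)

lemma kernel_phi:
  "a_kernel (S_wt P) (R_wt P :: (_ \<Rightarrow>\<^sub>0 'k::field) ring) phi = I_wt P"
proof
  have kernel: "a_kernel (S_wt P) (R_wt P :: (_ \<Rightarrow>\<^sub>0 'k) ring) phi
      = {p \<in> polys_in (conn_ideals P). phi p = 0}"
    unfolding a_kernel_def' carrier_S_wt by (simp add: R_wt_def ring_on_def)
  show "a_kernel (S_wt P) (R_wt P :: (_ \<Rightarrow>\<^sub>0 'k) ring) phi \<subseteq> I_wt P"
    unfolding kernel using kernel_subset_I_wt by blast
  have "{syz P J K | J K. {J, K} \<in> Pi_pairs P}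
      \<subseteq> a_kernel (S_wt P) (R_wt P :: (_ \<Rightarrow>\<^sub>0 'k) ring) phi"
    unfolding kernel using syz_in_S_wt phi_syz by (auto simp: Pi_pairs_iff)
  then show "I_wt P \<subseteq> a_kernel (S_wt P) (R_wt P :: (_ \<Rightarrow>\<^sub>0 'k) ring) phi"
    unfolding I_wt_def
    by (intro ring.genideal_minimal ring_S_wt ring_hom_ring.kernel_is_ideal ring_hom_phi)
qed

end

theorem mainTheorem3:
  fixes P :: "(real ^ 'n::finite) set"
  assumes "signed_poset P"
  shows "ring_hom_ring (S_wt P) (R_wt P :: ((int ^ 'n) \<Rightarrow>\<^sub>0 'k::field) ring) phi
       \<and> phi ` carrier (S_wt P) = carrier (R_wt P :: ((int ^ 'n) \<Rightarrow>\<^sub>0 'k) ring)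
       \<and> a_kernel (S_wt P) (R_wt P :: ((int ^ 'n) \<Rightarrow>\<^sub>0 'k) ring) phi = I_wt P"
proof -
  interpret signed_poset_order P
    by unfold_locales (rule assms)
  show ?thesis
    using ring_hom_phi kernel_phi phi_image unfolding carrier_S_wt carrier_R_wt by blast
qed

end
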